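(* Consider the FlexPD-C iterates described in the context with integer $T\ge1$, let $C=\sum_{t=0}^{T-1}(I-\alpha B)^t$, $M=C^{-1}(I-\alpha B)^T$, $z^k=\begin{bmatrix}x^k\\ \lambda^k\end{bmatrix}$, $z^*=\begin{bmatrix}x^*\\ \lambda^*\end{bmatrix}$ and $\mathcal G_C=\begin{bmatrix}M&0\\0&\frac{\alpha}{\beta}I\end{bmatrix}$. Let $0<\eta_4<2m$. If \[0<\beta<\frac{2m-\eta_4}{\rho(A'A)}\quad\text{and}\quad 0<\alpha<\frac{1-\Big(\frac{L^2}{L^2+\eta_4\rho(B)}\Big)^{1/T}}{\rho(B)},\] then there exists $\delta_C>0$ such that for all $k\ge0$, \[\|z^{k+1}-z^*\|_{\mathcal G_C}^2\le\frac{1}{1+\delta_C}\|z^k-z^*\|_{\mathcal G_C}^2,\] that is, $\|z^k-z^*\|_{\mathcal G_C}$ converges Q-linearly to $0$ and consequently $\|x^k-x^*\|_M$ converges R-linearly to $0$.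
   Context: Setting: $n$ agents are connected by a connected undirected graph with edge set $\mathcal E$, $\epsilon=|\mathcal E|$. For $x\in\mathbb R^n$ let $f(x)=\sum_{i=1}^n f_i(x_i)$, where each $f_i:\mathbb R\to\mathbb R$ is twice differentiable with $m\le f_i''\le L$ for constants $0<m\le L$; $\nabla f(x)=(f_1'(x_1),\dots,f_n'(x_n))'$. $A\in\mathbb R^{\epsilon\times n}$ is the edge–node incidence matrix (null space spanned by the all-ones vector). $B\in\mathbb R^{n\times n}$ is symmetric positive semidefinite with the same null space as $A$ (so $B\neq0$), off-diagonal entries nonzero only on edges. $x^*$ is the unique minimizer of $f$ subject to $Ax=0$ and $\lambda^*$ a Lagrange multiplier with $\nabla f(x^* )+A'\lambda^*=0$, $Ax^*=0$, $Bx^*=0$, chosen in the column space of $A$. FlexPD-C: given $\alpha,\beta>0$, $T\ge1$, $x^0$ arbitrary, $\lambda^0=0$; for $k\ge0$: $x^{k+1,0}=x^k$; for $t=1,\dots,T$, $x^{k+1,t}=x^{k+1,t-1}-\alpha\nabla f(x^k)-\alpha A'\lambda^k-\alpha Bx^{k+1,t-1}$; then $x^{k+1}=x^{k+1,T}$, $\lambda^{k+1}=\lambda^k+\beta Ax^{k+1}$. Notation: $\rho(S)$ largest eigenvalue of symmetric $S$; $\|v\|_S^2=v'Sv$; $\|\cdot\|$ Euclidean norm. *)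

theory Defs
  imports "HOL-Analysis.Analysis"
begin

text \<open>Matrix powers of a square matrix.\<close>
fun matpow :: "real^'n^'n \<Rightarrow> nat \<Rightarrow> real^'n^'n" where
  "matpow S 0 = mat 1"
| "matpow S (Suc t) = matpow S t ** S"

text \<open>Largest eigenvalue of a (symmetric) matrix.\<close>
definition rho :: "real^'n^'n \<Rightarrow> real" where
  "rho S = Max {c. \<exists>v. v \<noteq> 0 \<and> S *v v = c *\<^sub>R v}"

text \<open>Edge-node incidence matrix of an undirected simple graph with edge set 'e
  and node set 'n: every row has exactly one entry 1 and one entry -1 (at the two
  distinct endpoints of the edge, arbitrary orientation), zero elsewhere, and
  distinct rows correspond to distinct edges.\<close>
definition incidence_matrix :: "real^'n^'e \<Rightarrow> bool" where
  "incidence_matrix A \<longleftrightarrow>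
     (\<forall>e. \<exists>i j. i \<noteq> j \<and> A$e$i = 1 \<and> A$e$j = -1 \<and> (\<forall>k. k \<noteq> i \<and> k \<noteq> j \<longrightarrow> A$e$k = 0))
     \<and> inj (\<lambda>e. {i. A$e$i \<noteq> 0})"

definition adjacent :: "real^'n^'e \<Rightarrow> 'n \<Rightarrow> 'n \<Rightarrow> bool" where
  "adjacent A i j \<longleftrightarrow> i \<noteq> j \<and> (\<exists>e. A$e$i \<noteq> 0 \<and> A$e$j \<noteq> 0)"

definition graph_connected :: "real^'n^'e \<Rightarrow> bool" where
  "graph_connected A \<longleftrightarrow> (\<forall>i j. (i, j) \<in> {(a, b). adjacent A a b}\<^sup>*)"

text \<open>Gradient of the separable function f(x) = sum_i f_i(x_i), given the
  derivatives df i of the f_i.\<close>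
definition grad :: "('n \<Rightarrow> real \<Rightarrow> real) \<Rightarrow> real^'n \<Rightarrow> real^'n" where
  "grad df x = (\<chi> i. df i (x$i))"

text \<open>FlexPD-C inner loop: x^{k+1,t}.\<close>
fun flex_inner :: "real \<Rightarrow> real^'n^'e \<Rightarrow> real^'n^'n \<Rightarrow> ('n \<Rightarrow> real \<Rightarrow> real)
     \<Rightarrow> real^'n \<Rightarrow> real^'e \<Rightarrow> nat \<Rightarrow> real^'n" where
  "flex_inner \<alpha> A B df xk lk 0 = xk"
| "flex_inner \<alpha> A B df xk lk (Suc t) =
     flex_inner \<alpha> A B df xk lk t - \<alpha> *\<^sub>R grad df xk - \<alpha> *\<^sub>R (transpose A *v lk)
       - \<alpha> *\<^sub>R (B *v flex_inner \<alpha> A B df xk lk t)"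

text \<open>C = sum_{t<T} (I - alpha B)^t and M = C^{-1} (I - alpha B)^T.\<close>
definition Cmat :: "real \<Rightarrow> real^'n^'n \<Rightarrow> nat \<Rightarrow> real^'n^'n" where
  "Cmat \<alpha> B T = (\<Sum>t<T. matpow (mat 1 - \<alpha> *\<^sub>R B) t)"

definition Mmat :: "real \<Rightarrow> real^'n^'n \<Rightarrow> nat \<Rightarrow> real^'n^'n" where
  "Mmat \<alpha> B T = matrix_inv (Cmat \<alpha> B T) ** matpow (mat 1 - \<alpha> *\<^sub>R B) T"

text \<open>Squared G_C-norm of z = (x, l), with G_C = diag(M, (alpha/beta) I).\<close>
definition GC_normsq :: "real \<Rightarrow> real \<Rightarrow> real^'n^'n \<Rightarrow> nat \<Rightarrow> real^'n \<Rightarrow> real^'e \<Rightarrow> real" where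
  "GC_normsq \<alpha> \<beta> B T x l = x \<bullet> (Mmat \<alpha> B T *v x) + (\<alpha> / \<beta>) * (l \<bullet> l)"

end

(* Write e = x^k - xs, mu = lambda^k - ls and d = grad f(x^k) - grad f(xs). In an
   orthonormal eigenbasis of B the inner loop is a scalar geometric recursion, and one outer
   iteration becomes
       M (e' - e) + alpha B e' + alpha (d + A' mu) = 0,      mu' = mu + beta A e',
   because M + alpha B = C^-1. Expanding the G_C-norm along this recursion, using that
   d = H e with H diagonal and m <= H <= L (mean value theorem) and Young's inequality with
   weight eta_4, the squared G_C-norm decreases by at least
       (kappa - alpha L^2 / eta_4) |e' - e|^2 + alpha (2 m - eta_4 - beta rho(A'A)) |e'|^2,
   where kappa is the least eigenvalue of M. The condition on alpha is exactly what makes every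
   eigenvalue of M exceed alpha L^2 / eta_4, and the condition on beta makes the second
   coefficient positive. Conversely, the first relation expresses A' mu' through e, e' and d,
   and A' is bounded below on the column space of A, which contains every mu'; so the squared
   G_C-norm of (e', mu') is at most a constant times |e' - e|^2 + |e'|^2. Together these give
   contraction by a fixed factor 1 / (1 + delta). *)

theory Submission
  imports Defs
begin

section \<open>Orthonormal eigenbases of real symmetric matrices\<close>

lemma inner_matrix_vector_transpose:
  fixes A :: "real^'n^'m"
  shows "(A *v x) \<bullet> y = x \<bullet> (transpose A *v y)"
  by (metis dot_lmul_matrix vector_transpose_matrix)

lemma symmetric_matrix_inner:
  fixes S :: "real^'n^'n"
  assumes "transpose S = S"
  shows "(S *v x) \<bullet> y = x \<bullet> (S *v y)"
  by (metis assms inner_matrix_vector_transpose)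

lemma linear_coeff_zero_if_quadratic_nonneg:
  fixes a b :: real
  assumes nonneg: "\<And>t. 0 \<le> a * t + b * t\<^sup>2"
  shows "a = 0"
proof (rule ccontr)
  assume "a \<noteq> 0"
  define s where "s = \<bar>b\<bar> + 1"
  have "s \<noteq> 0" "b - s < 0" unfolding s_def by linarith+
  then have "a * (- a / s) + b * (- a / s)\<^sup>2 = (a / s)\<^sup>2 * (b - s)"
    by (simp add: field_simps power2_eq_square)
  also have "\<dots> < 0" using \<open>a \<noteq> 0\<close> \<open>s \<noteq> 0\<close> \<open>b - s < 0\<close> by (simp add: mult_pos_neg)
  finally show False using nonneg by (metis not_le)
qed

lemma symmetric_matrix_rayleigh_max_eigenvector:
  fixes S :: "real^'n^'n"
  assumes sym: "transpose S = S" and V: "subspace V" and invariant: "S *v v0 \<in> V"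
    and v0: "v0 \<in> V" "v0 \<bullet> v0 = 1" and c: "c = v0 \<bullet> (S *v v0)"
    and max: "\<forall>y\<in>V. y \<bullet> (S *v y) \<le> c * (y \<bullet> y)"
  shows "S *v v0 = c *\<^sub>R v0"
proof -
  define r where "r = S *v v0 - c *\<^sub>R v0"
  have Sv0: "S *v v0 = r + c *\<^sub>R v0" unfolding r_def by simp
  have "r \<in> V" unfolding r_def using V invariant v0(1) by (simp add: subspace_diff subspace_scale)
  have rv0: "r \<bullet> v0 = 0"
    using v0(2) by (simp add: r_def c inner_diff_left inner_commute[of "S *v v0"])
  \<comment> \<open>first-order optimality of the Rayleigh quotient at \<open>v0\<close> in the direction \<open>r\<close>\<close>
  have "0 \<le> (- 2 * (r \<bullet> r)) * t + (c * (r \<bullet> r) - r \<bullet> (S *v r)) * t\<^sup>2" for t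
  proof -
    have "c + 2 * t * (r \<bullet> r) + t\<^sup>2 * (r \<bullet> (S *v r)) = (v0 + t *\<^sub>R r) \<bullet> (S *v (v0 + t *\<^sub>R r))"
      using rv0 v0(2) symmetric_matrix_inner[OF sym, of r v0]
      by (simp add: matrix_vector_right_distrib matrix_vector_mult_scaleR Sv0 inner_add_left
          inner_add_right inner_commute power2_eq_square algebra_simps)
    also have "\<dots> \<le> c * ((v0 + t *\<^sub>R r) \<bullet> (v0 + t *\<^sub>R r))"
      using max V v0(1) \<open>r \<in> V\<close> by (simp add: subspace_add subspace_scale)
    also have "\<dots> = c * (1 + t\<^sup>2 * (r \<bullet> r))"
      using rv0 v0(2) by (simp add: inner_add_left inner_add_right inner_commute power2_eq_square)
    finally show ?thesis by (simp add: algebra_simps)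
  qed
  then have "r = 0" using linear_coeff_zero_if_quadratic_nonneg by fastforce
  then show ?thesis using Sv0 by simp
qed

lemma symmetric_matrix_eigenvector_orthogonal:
  fixes S :: "real^'n^'n"
  assumes sym: "transpose S = S" and eig: "\<forall>e\<in>E. \<exists>c. S *v e = c *\<^sub>R e"
    and ne: "span E \<noteq> UNIV"
  obtains v c where "norm v = 1" "\<forall>e\<in>E. v \<bullet> e = 0" "S *v v = c *\<^sub>R v"
proof -
  define V where "V = {v::real^'n. \<forall>e\<in>E. v \<bullet> e = 0}"
  define q where "q v = v \<bullet> (S *v v)" for v
  have V: "subspace V" unfolding V_def subspace_def by (simp add: inner_add_left)
  obtain x0 where "x0 \<noteq> 0" "\<And>y. y \<in> span E \<Longrightarrow> orthogonal x0 y"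
    using orthogonal_to_subspace_exists_gen[of E UNIV] ne by auto
  then have "x0 /\<^sub>R norm x0 \<in> V \<inter> sphere 0 1"
    unfolding V_def by (auto simp: orthogonal_def span_base)
  moreover have "V = (\<Inter>e\<in>E. {v. e \<bullet> v = 0})" unfolding V_def by (auto simp: inner_commute)
  then have "closed V" by (auto intro: closed_hyperplane)
  then have "compact (V \<inter> sphere 0 1)" by (simp add: closed_Int_compact)
  moreover have "continuous_on (V \<inter> sphere 0 1) q" unfolding q_def by (intro continuous_intros)
  ultimately obtain v0 where v0: "v0 \<in> V" "norm v0 = 1"
    and max: "\<And>y. y \<in> V \<inter> sphere 0 1 \<Longrightarrow> q y \<le> q v0"
    using continuous_attains_sup[of "V \<inter> sphere 0 1" q] by fastforce
  have "q y \<le> q v0 * (y \<bullet> y)" if "y \<in> V" for y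
  proof (cases "y = 0")
    case False
    have "q (y /\<^sub>R norm y) \<le> q v0" using that False V by (intro max) (simp add: subspace_scale)
    moreover have "q (y /\<^sub>R norm y) = q y / (y \<bullet> y)"
      unfolding q_def by (simp add: matrix_vector_mult_scaleR power2_norm_eq_inner[symmetric]
          power2_eq_square divide_inverse mult_ac)
    ultimately show ?thesis using False by (simp add: divide_le_eq mult.commute)
  qed (simp add: q_def)
  moreover have "S *v v0 \<in> V"
    using v0(1) eig unfolding V_def by (auto simp: symmetric_matrix_inner[OF sym])
  ultimately have "S *v v0 = q v0 *\<^sub>R v0"
    using v0 by (intro symmetric_matrix_rayleigh_max_eigenvector[OF sym V]) (auto simp: q_def norm_eq_1)
  then show ?thesis using that v0 unfolding V_def by blast
qed

definition orthonormal_basis :: "(real^'n) set \<Rightarrow> bool" where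
  "orthonormal_basis E \<longleftrightarrow>
     finite E \<and> (\<forall>e\<in>E. norm e = 1) \<and> pairwise orthogonal E \<and> span E = UNIV"

theorem symmetric_matrix_orthonormal_eigenbasis:
  fixes S :: "real^'n^'n"
  assumes sym: "transpose S = S"
  obtains E s where "orthonormal_basis E" "\<forall>e\<in>E. S *v e = s e *\<^sub>R e"
proof -
  define eigensystem where "eigensystem E \<longleftrightarrow> finite E \<and> pairwise orthogonal E \<and>
      (\<forall>e\<in>E. norm e = 1 \<and> (\<exists>c. S *v e = c *\<^sub>R e))" for E :: "(real^'n) set"
  have "\<exists>E. eigensystem E \<and> span E = UNIV" if "eigensystem E0" for E0
    using that
  proof (induction "DIM(real^'n) - card E0" arbitrary: E0 rule: less_induct)
    case less
    show ?case
    proof (cases "span E0 = UNIV")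
      case False
      have "\<forall>e\<in>E0. \<exists>c. S *v e = c *\<^sub>R e" using less.prems unfolding eigensystem_def by blast
      then obtain v c where v: "norm v = 1" "\<forall>e\<in>E0. v \<bullet> e = 0" "S *v v = c *\<^sub>R v"
        using symmetric_matrix_eigenvector_orthogonal[OF sym _ False] by blast
      have "v \<notin> E0" using v(1,2) by (metis norm_eq_1 zero_neq_one)
      have E1: "eigensystem (insert v E0)"
        using less.prems v by (auto simp: eigensystem_def pairwise_insert orthogonal_def inner_commute)
      then have "independent (insert v E0)"
        by (intro pairwise_orthogonal_independent) (auto simp: eigensystem_def)
      then have "card (insert v E0) \<le> DIM(real^'n)" using independent_bound by blast
      moreover have "card (insert v E0) = Suc (card E0)"
        using less.prems \<open>v \<notin> E0\<close> by (simp add: eigensystem_def)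
      ultimately show ?thesis using less.hyps[OF _ E1] by simp
    qed (use less.prems in blast)
  qed
  from this[of "{}"] obtain E where E: "eigensystem E" "span E = UNIV"
    by (auto simp: eigensystem_def)
  define s where "s e = (SOME c. S *v e = c *\<^sub>R e)" for e
  have "\<forall>e\<in>E. S *v e = s e *\<^sub>R e"
    using E(1) unfolding eigensystem_def s_def by (metis (mono_tags) someI_ex)
  moreover have "orthonormal_basis E" using E unfolding eigensystem_def orthonormal_basis_def by blast
  ultimately show ?thesis using that by blast
qed

lemma orthonormal_basis_finite: "orthonormal_basis E \<Longrightarrow> finite E"
  unfolding orthonormal_basis_def by blast

lemma orthonormal_basis_inner_self: "orthonormal_basis E \<Longrightarrow> e \<in> E \<Longrightarrow> e \<bullet> e = 1"
  unfolding orthonormal_basis_def by (simp add: norm_eq_1)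

lemma orthonormal_basis_eq_0:
  assumes E: "orthonormal_basis E" and orth: "\<forall>e\<in>E. v \<bullet> e = 0"
  shows "v = 0"
proof -
  have "v \<in> span E" using E unfolding orthonormal_basis_def by simp
  then have "orthogonal v v" by (rule orthogonal_to_span) (use orth in \<open>simp add: orthogonal_def\<close>)
  then show ?thesis using orthogonal_self by blast
qed

lemma orthonormal_basis_eq:
  assumes "orthonormal_basis E" and "\<forall>e\<in>E. v \<bullet> e = u \<bullet> e"
  shows "v = u"
  using orthonormal_basis_eq_0[of E "v - u"] assms by (simp add: inner_diff_left)

lemma orthonormal_basis_nonempty: "orthonormal_basis E \<Longrightarrow> E \<noteq> {}"
  using orthonormal_basis_eq_0[of E 1] by (metis empty_iff one_index zero_index zero_neq_one)

lemma orthonormal_basis_sum_coord: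
  assumes E: "orthonormal_basis E" and e: "e \<in> E"
  shows "(\<Sum>f\<in>E. a f *\<^sub>R f) \<bullet> e = a e"
proof -
  have "f \<bullet> e = (if f = e then 1 else 0)" if "f \<in> E" for f
    using E e that orthonormal_basis_inner_self[OF E e]
    unfolding orthonormal_basis_def pairwise_def orthogonal_def by auto
  then have "(\<Sum>f\<in>E. a f *\<^sub>R f) \<bullet> e = (\<Sum>f\<in>E. if f = e then a f else 0)"
    by (auto simp: inner_sum_left intro: sum.cong)
  also have "\<dots> = a e" using orthonormal_basis_finite[OF E] e by simp
  finally show ?thesis .
qed

lemma orthonormal_basis_expansion:
  assumes E: "orthonormal_basis E"
  shows "v = (\<Sum>e\<in>E. (v \<bullet> e) *\<^sub>R e)"
  using orthonormal_basis_sum_coord[OF E] by (intro orthonormal_basis_eq[OF E]) simp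

lemma orthonormal_basis_parseval:
  assumes E: "orthonormal_basis E"
  shows "u \<bullet> v = (\<Sum>e\<in>E. (u \<bullet> e) * (v \<bullet> e))"
  by (subst (1) orthonormal_basis_expansion[OF E, of v]) (simp add: inner_sum_right mult.commute)

lemma orthonormal_eigenbasis_coord:
  fixes P :: "real^'n^'n"
  assumes E: "orthonormal_basis E" and P: "\<forall>f\<in>E. P *v f = p f *\<^sub>R f" and e: "e \<in> E"
  shows "(P *v v) \<bullet> e = p e * (v \<bullet> e)"
proof -
  have "P *v v = P *v (\<Sum>f\<in>E. (v \<bullet> f) *\<^sub>R f)"
    by (rule arg_cong[OF orthonormal_basis_expansion[OF E]])
  also have "\<dots> = (\<Sum>f\<in>E. (v \<bullet> f * p f) *\<^sub>R f)"
    using P by (simp add: linear_sum matrix_vector_mult_scaleR)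
  finally show ?thesis using orthonormal_basis_sum_coord[OF E e] by (simp add: mult.commute)
qed

lemma orthonormal_eigenbasis_quadratic_form:
  fixes P :: "real^'n^'n"
  assumes E: "orthonormal_basis E" and P: "\<forall>e\<in>E. P *v e = p e *\<^sub>R e"
  shows "u \<bullet> (P *v v) = (\<Sum>e\<in>E. p e * (u \<bullet> e) * (v \<bullet> e))"
  unfolding orthonormal_basis_parseval[OF E, of u "P *v v"]
  by (simp add: orthonormal_eigenbasis_coord[OF E P] mult_ac)

lemma orthonormal_eigenbasis_quadratic_form_gt:
  fixes P :: "real^'n^'n"
  assumes E: "orthonormal_basis E" and P: "\<forall>e\<in>E. P *v e = p e *\<^sub>R e"
    and gt: "\<forall>e\<in>E. \<kappa>\<^sub>0 < p e"
  obtains \<kappa> where "\<kappa>\<^sub>0 < \<kappa>" "\<forall>v. \<kappa> * (v \<bullet> v) \<le> v \<bullet> (P *v v)"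
proof -
  define \<kappa> where "\<kappa> = Min (p ` E)"
  have fin: "finite (p ` E)" "p ` E \<noteq> {}"
    using orthonormal_basis_finite[OF E] orthonormal_basis_nonempty[OF E] by auto
  have "\<kappa>\<^sub>0 < \<kappa>" using fin gt by (simp add: \<kappa>_def)
  moreover have "\<kappa> * (v \<bullet> v) \<le> v \<bullet> (P *v v)" for v
  proof -
    have "\<kappa> * (v \<bullet> v) = (\<Sum>e\<in>E. \<kappa> * (v \<bullet> e) * (v \<bullet> e))"
      by (simp add: orthonormal_basis_parseval[OF E, of v v] sum_distrib_left mult.assoc)
    also have "\<dots> \<le> (\<Sum>e\<in>E. p e * (v \<bullet> e) * (v \<bullet> e))"
      using fin by (intro sum_mono) (simp add: \<kappa>_def mult.assoc mult_right_mono)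
    also have "\<dots> = v \<bullet> (P *v v)" by (simp add: orthonormal_eigenbasis_quadratic_form[OF E P])
    finally show ?thesis .
  qed
  ultimately show ?thesis using that by blast
qed

lemma symmetric_matrix_eigenvalues_finite:
  fixes S :: "real^'n^'n"
  assumes sym: "transpose S = S"
  shows "finite {c. \<exists>v. v \<noteq> 0 \<and> S *v v = c *\<^sub>R v}"
proof -
  obtain E s where E: "orthonormal_basis E" and s: "\<forall>e\<in>E. S *v e = s e *\<^sub>R e"
    using symmetric_matrix_orthonormal_eigenbasis[OF sym] by blast
  have "c \<in> s ` E" if "v \<noteq> 0" "S *v v = c *\<^sub>R v" for v c
  proof -
    obtain e where e: "e \<in> E" "v \<bullet> e \<noteq> 0" using orthonormal_basis_eq_0[OF E] \<open>v \<noteq> 0\<close> by blast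
    have "c * (v \<bullet> e) = s e * (v \<bullet> e)"
      using orthonormal_eigenbasis_coord[OF E s e(1), of v] that(2) by simp
    then show ?thesis using e by auto
  qed
  then have "{c. \<exists>v. v \<noteq> 0 \<and> S *v v = c *\<^sub>R v} \<subseteq> s ` E" by blast
  then show ?thesis using orthonormal_basis_finite[OF E] finite_subset by blast
qed

lemma eigenvalue_le_rho:
  fixes S :: "real^'n^'n"
  assumes "transpose S = S" and "v \<noteq> 0" and "S *v v = c *\<^sub>R v"
  shows "c \<le> rho S"
  unfolding rho_def
  by (rule Max_ge[OF symmetric_matrix_eigenvalues_finite[OF assms(1)]]) (use assms in blast)

lemma quadratic_form_le_rho:
  fixes S :: "real^'n^'n"
  assumes sym: "transpose S = S"
  shows "v \<bullet> (S *v v) \<le> rho S * (v \<bullet> v)"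
proof -
  obtain E s where E: "orthonormal_basis E" and s: "\<forall>e\<in>E. S *v e = s e *\<^sub>R e"
    using symmetric_matrix_orthonormal_eigenbasis[OF sym] by blast
  have "s e \<le> rho S" if "e \<in> E" for e
    using that s orthonormal_basis_inner_self[OF E that]
    by (intro eigenvalue_le_rho[OF sym, of e]) auto
  then have "v \<bullet> (S *v v) \<le> (\<Sum>e\<in>E. rho S * (v \<bullet> e) * (v \<bullet> e))"
    unfolding orthonormal_eigenbasis_quadratic_form[OF E s]
    by (intro sum_mono) (simp add: mult.assoc mult_right_mono)
  also have "\<dots> = rho S * (v \<bullet> v)"
    by (simp add: orthonormal_basis_parseval[OF E, of v v] sum_distrib_left mult.assoc)
  finally show ?thesis .
qed

lemma rho_nonneg:
  fixes S :: "real^'n^'n"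
  assumes sym: "transpose S = S" and psd: "\<forall>v. 0 \<le> v \<bullet> (S *v v)"
  shows "0 \<le> rho S"
proof -
  obtain E s where E: "orthonormal_basis E" and s: "\<forall>e\<in>E. S *v e = s e *\<^sub>R e"
    using symmetric_matrix_orthonormal_eigenbasis[OF sym] by blast
  obtain e where e: "e \<in> E" using orthonormal_basis_nonempty[OF E] by blast
  have "s e = e \<bullet> (S *v e)" using s e orthonormal_basis_inner_self[OF E e] by simp
  also have "\<dots> \<ge> 0" using psd by blast
  moreover have "s e \<le> rho S"
    using s e orthonormal_basis_inner_self[OF E e] by (intro eigenvalue_le_rho[OF sym, of e]) auto
  ultimately show ?thesis by linarith
qed

section \<open>The eigenvalues of M\<close>

definition Mmat_eigenvalue :: "real \<Rightarrow> nat \<Rightarrow> real \<Rightarrow> real" where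
  "Mmat_eigenvalue \<alpha> T b = (1 - \<alpha> * b) ^ T / (\<Sum>t<T. (1 - \<alpha> * b) ^ t)"

lemma weighted_geometric_mean_le:
  fixes x \<theta> :: real
  assumes "0 < x" "0 \<le> \<theta>" "\<theta> \<le> 1"
  shows "x powr \<theta> \<le> \<theta> * x + (1 - \<theta>)"
  using Youngs_inequality_0[of \<theta> "1 - \<theta>" x 1] assms by simp

lemma stepsize_bound_zero_eigenvalue:
  fixes \<alpha> \<rho> L \<eta> s :: real
  assumes "0 < s" "s ^ T * (L\<^sup>2 + \<eta> * \<rho>) = L\<^sup>2" "\<alpha> * \<rho> < 1 - s"
    and "0 < \<rho>" "0 < L" "1 \<le> T"
  shows "real T * \<alpha> * L\<^sup>2 < \<eta>"
proof -
  define x where "x = 1 / s - 1"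
  have "1 + real T * x \<le> (1 + x) ^ T"
    by (rule Bernoulli_inequality) (use assms in \<open>simp add: x_def\<close>)
  also have "(1 + x) ^ T * L\<^sup>2 = L\<^sup>2 + \<eta> * \<rho>"
    using assms(1,2) by (simp add: x_def power_divide field_simps)
  finally have "real T * x * L\<^sup>2 \<le> \<eta> * \<rho>"
    using assms(5) by (simp add: mult_right_mono algebra_simps)
  moreover have "1 - s \<le> x"
    using assms(1) zero_le_power2[of "1 - s"] by (simp add: x_def field_simps power2_eq_square)
  then have "real T * (\<alpha> * \<rho>) * L\<^sup>2 < real T * x * L\<^sup>2"
    using assms(3,5,6) by (intro mult_strict_right_mono) auto
  ultimately have "(real T * \<alpha> * L\<^sup>2) * \<rho> < \<eta> * \<rho>" by (simp add: mult_ac)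
  then show ?thesis using assms(4) by simp
qed

text \<open>Weighted AM-GM with weight \<open>b / \<rho>\<close> interpolates between the hypothesis, which is the
  case \<open>b = \<rho>\<close>, and equality at \<open>b = 0\<close>.\<close>

lemma stepsize_bound_pos_eigenvalue:
  fixes \<alpha> \<rho> L \<eta> s b :: real
  assumes s: "0 < s" "s ^ T * (L\<^sup>2 + \<eta> * \<rho>) = L\<^sup>2" and \<alpha>: "\<alpha> * \<rho> < 1 - s"
    and b: "0 < b" "b \<le> \<rho>" and "0 < L" "0 < \<eta>" "1 \<le> T"
  shows "L\<^sup>2 < (1 - \<alpha> * b) ^ T * (L\<^sup>2 + \<eta> * b)"
proof -
  define \<theta> where "\<theta> = b / \<rho>"
  define r where "r = s ^ T"
  have \<rho>: "0 < \<rho>" and \<theta>: "0 < \<theta>" "\<theta> \<le> 1" using b by (auto simp: \<theta>_def)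
  have r: "0 < r" "1 / r = 1 + \<eta> * \<rho> / L\<^sup>2"
    using s \<open>0 < L\<close> by (auto simp: r_def field_simps)
  have "s powr \<theta> < (1 - \<alpha> * \<rho>) powr \<theta>"
    using s(1) \<alpha> \<theta>(1) by (intro powr_less_mono2) auto
  also have "\<dots> \<le> \<theta> * (1 - \<alpha> * \<rho>) + (1 - \<theta>)"
    using s(1) \<alpha> \<theta> by (intro weighted_geometric_mean_le) auto
  also have "\<dots> = 1 - \<alpha> * b" using \<rho> by (simp add: \<theta>_def field_simps)
  finally have "(s powr \<theta>) ^ T < (1 - \<alpha> * b) ^ T"
    using s(1) \<open>1 \<le> T\<close> by (intro power_strict_mono) auto
  moreover have "(s powr \<theta>) ^ T = r powr \<theta>"
    using s(1) by (simp add: r_def powr_realpow[symmetric] powr_powr mult.commute)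
  ultimately have wT: "r powr \<theta> < (1 - \<alpha> * b) ^ T" by simp
  have "(1 / r) powr \<theta> \<le> \<theta> * (1 / r) + (1 - \<theta>)"
    using r(1) \<theta> by (intro weighted_geometric_mean_le) auto
  also have "\<dots> = 1 + \<eta> * b / L\<^sup>2" using \<rho> by (simp add: r(2) \<theta>_def field_simps)
  finally have bound: "L\<^sup>2 * (1 / r) powr \<theta> \<le> L\<^sup>2 + \<eta> * b"
    using \<open>0 < L\<close> by (simp add: field_simps)
  have "L\<^sup>2 = r powr \<theta> * (L\<^sup>2 * (1 / r) powr \<theta>)"
    using r(1) by (simp add: powr_divide)
  also have "\<dots> < (1 - \<alpha> * b) ^ T * (L\<^sup>2 * (1 / r) powr \<theta>)"
    using wT r(1) \<open>0 < L\<close> by (intro mult_strict_right_mono) auto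
  also have "\<dots> \<le> (1 - \<alpha> * b) ^ T * (L\<^sup>2 + \<eta> * b)"
    using wT bound by (intro mult_left_mono) (auto intro: order_trans[OF powr_ge_zero less_imp_le])
  finally show ?thesis .
qed

lemma geometric_sum_pos:
  fixes w :: real
  assumes "0 < w" "1 \<le> T"
  shows "0 < (\<Sum>t<T. w ^ t)"
  using assms by (intro sum_pos) (auto simp: lessThan_empty_iff)

lemma less_divide_imp_mult_less:
  fixes \<alpha> a \<rho> :: real
  assumes "0 < \<alpha>" "\<alpha> < a / \<rho>" "0 \<le> \<rho> \<or> 0 \<le> a"
  shows "0 < \<rho>" "\<alpha> * \<rho> < a"
proof -
  show "0 < \<rho>"
  proof (rule ccontr)
    assume "\<not> 0 < \<rho>"
    then have "a / \<rho> \<le> 0" using assms(3) by (cases "\<rho> = 0") (auto simp: divide_nonneg_neg)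
    then show False using assms(1,2) by linarith
  qed
  then show "\<alpha> * \<rho> < a" using assms(2) by (simp add: pos_less_divide_eq)
qed

lemma stepsize_bound_rho:
  fixes \<alpha> \<rho> x a :: real
  assumes "0 < \<alpha>" "0 \<le> \<rho>" "\<alpha> < (1 - x powr a) / \<rho>"
  shows "0 < \<rho>" "\<alpha> * \<rho> < 1"
proof -
  show "0 < \<rho>" using less_divide_imp_mult_less(1)[OF assms(1,3)] assms(2) by blast
  have "\<alpha> * \<rho> < 1 - x powr a" using less_divide_imp_mult_less(2)[OF assms(1,3)] assms(2) by blast
  then show "\<alpha> * \<rho> < 1" using powr_ge_zero[of x a] by linarith
qed

lemma stepsize_bound_root:
  fixes \<alpha> \<rho> L \<eta> :: real
  assumes "0 < \<rho>" "0 < L" "0 < \<eta>" "1 \<le> T"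
    and \<alpha>_bound: "\<alpha> < (1 - (L\<^sup>2 / (L\<^sup>2 + \<eta> * \<rho>)) powr (1 / real T)) / \<rho>"
  obtains s where "0 < s" "s ^ T * (L\<^sup>2 + \<eta> * \<rho>) = L\<^sup>2" "\<alpha> * \<rho> < 1 - s"
proof -
  define r where "r = L\<^sup>2 / (L\<^sup>2 + \<eta> * \<rho>)"
  define s where "s = r powr (1 / real T)"
  have denom: "0 < L\<^sup>2 + \<eta> * \<rho>" using assms by (simp add: add_pos_pos)
  then have "0 < r" using assms(2) by (simp add: r_def)
  then have "0 < s" by (simp add: s_def)
  have "s ^ T = s powr real T" using \<open>0 < s\<close> by (simp add: powr_realpow)
  also have "\<dots> = r powr (1 / real T * real T)" by (simp add: s_def powr_powr)
  also have "\<dots> = r" using \<open>0 < r\<close> assms(4) by simp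
  finally have "s ^ T * (L\<^sup>2 + \<eta> * \<rho>) = L\<^sup>2" using denom by (simp add: r_def)
  moreover have "\<alpha> * \<rho> < 1 - s"
    using \<alpha>_bound assms(1) by (simp add: s_def r_def pos_less_divide_eq mult.commute)
  ultimately show ?thesis using that \<open>0 < s\<close> by blast
qed

lemma Mmat_eigenvalue_gt:
  fixes \<alpha> \<rho> L \<eta> b :: real
  assumes "0 < \<alpha>" "0 < \<rho>" "0 < L" "0 < \<eta>" "1 \<le> T" and b: "0 \<le> b" "b \<le> \<rho>"
    and \<alpha>_bound: "\<alpha> < (1 - (L\<^sup>2 / (L\<^sup>2 + \<eta> * \<rho>)) powr (1 / real T)) / \<rho>"
  shows "\<alpha> * L\<^sup>2 / \<eta> < Mmat_eigenvalue \<alpha> T b"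
proof -
  obtain s where s: "0 < s" "s ^ T * (L\<^sup>2 + \<eta> * \<rho>) = L\<^sup>2" and \<alpha>\<rho>: "\<alpha> * \<rho> < 1 - s"
    using stepsize_bound_root[OF assms(2-5) \<alpha>_bound] by blast
  define w where "w = 1 - \<alpha> * b"
  have "\<alpha> * b \<le> \<alpha> * \<rho>" using b assms(1) by simp
  then have sum_pos: "0 < (\<Sum>t<T. w ^ t)"
    using \<alpha>\<rho> s(1) assms(5) by (intro geometric_sum_pos) (auto simp: w_def)
  show ?thesis
  proof (cases "b = 0")
    case True
    have "real T * \<alpha> * L\<^sup>2 < \<eta>" using stepsize_bound_zero_eigenvalue[OF s \<alpha>\<rho>] assms by simp
    then show ?thesis using True assms(4,5) by (simp add: Mmat_eigenvalue_def field_simps)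
  next
    case False
    have key: "L\<^sup>2 < w ^ T * (L\<^sup>2 + \<eta> * b)"
      unfolding w_def using stepsize_bound_pos_eigenvalue[OF s \<alpha>\<rho>] False assms by simp
    have geometric: "\<alpha> * b * (\<Sum>t<T. w ^ t) = 1 - w ^ T"
      using one_diff_power_eq[of w T] by (simp add: w_def)
    have "(\<alpha> * L\<^sup>2 * (\<Sum>t<T. w ^ t)) * (\<alpha> * b) = \<alpha> * (L\<^sup>2 * (1 - w ^ T))"
      by (simp add: geometric[symmetric] algebra_simps)
    also have "\<dots> < \<alpha> * (\<eta> * w ^ T * b)"
      using key assms(1) by (intro mult_strict_left_mono) (simp_all add: algebra_simps)
    finally have "(\<alpha> * L\<^sup>2 * (\<Sum>t<T. w ^ t)) * (\<alpha> * b) < (\<eta> * w ^ T) * (\<alpha> * b)"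
      by (simp add: algebra_simps)
    then have "\<alpha> * L\<^sup>2 * (\<Sum>t<T. w ^ t) < \<eta> * w ^ T"
      using False b assms(1) by (simp add: mult_less_cancel_right)
    then show ?thesis
      using sum_pos assms(4) by (simp add: Mmat_eigenvalue_def w_def[symmetric] field_simps)
  qed
qed

lemma matpow_eigenvector:
  assumes "W *v e = w *\<^sub>R e"
  shows "matpow W t *v e = (w ^ t) *\<^sub>R e"
  by (induction t)
    (simp_all add: assms matrix_vector_mul_assoc[symmetric] matrix_vector_mult_scaleR)

lemma step_matrix_eigenvector:
  fixes B :: "real^'n^'n"
  assumes "B *v e = b *\<^sub>R e"
  shows "(mat 1 - \<alpha> *\<^sub>R B) *v e = (1 - \<alpha> * b) *\<^sub>R e"
  using assms
  by (simp add: matrix_vector_mult_diff_rdistrib scaleR_matrix_vector_assoc[symmetric] algebra_simps)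

lemma Cmat_eigenvector:
  fixes B :: "real^'n^'n"
  assumes "B *v e = b *\<^sub>R e"
  shows "Cmat \<alpha> B T *v e = (\<Sum>t<T. (1 - \<alpha> * b) ^ t) *\<^sub>R e"
  by (induction T) (simp_all add: Cmat_def matrix_vector_mult_add_rdistrib scaleR_add_left
      matpow_eigenvector[OF step_matrix_eigenvector[OF assms]])

lemma matrix_inv_left:
  fixes A :: "real^'n^'n"
  assumes "invertible A"
  shows "matrix_inv A ** A = mat 1"
  using assms unfolding invertible_def matrix_inv_def by (metis (mono_tags, lifting) someI_ex)

lemma orthonormal_eigenbasis_invertible:
  fixes P :: "real^'n^'n"
  assumes E: "orthonormal_basis E" and P: "\<forall>e\<in>E. P *v e = p e *\<^sub>R e" and p: "\<forall>e\<in>E. p e \<noteq> 0"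
  shows "invertible P"
proof -
  have "v = 0" if "P *v v = 0" for v
  proof (rule orthonormal_basis_eq_0[OF E], rule ballI)
    fix e assume "e \<in> E"
    then have "p e * (v \<bullet> e) = 0" using orthonormal_eigenbasis_coord[OF E P, of e v] that by simp
    then show "v \<bullet> e = 0" using p \<open>e \<in> E\<close> by simp
  qed
  then show ?thesis using matrix_left_invertible_ker invertible_left_inverse by blast
qed

lemma Mmat_eigenvector:
  fixes B :: "real^'n^'n"
  assumes inv: "invertible (Cmat \<alpha> B T)" and e: "B *v e = b *\<^sub>R e"
    and c: "(\<Sum>t<T. (1 - \<alpha> * b) ^ t) \<noteq> 0"
  shows "Mmat \<alpha> B T *v e = Mmat_eigenvalue \<alpha> T b *\<^sub>R e"
proof -
  let ?c = "\<Sum>t<T. (1 - \<alpha> * b) ^ t" and ?Ci = "matrix_inv (Cmat \<alpha> B T)"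
  have "e = ?Ci *v (Cmat \<alpha> B T *v e)" by (simp add: matrix_vector_mul_assoc matrix_inv_left[OF inv])
  also have "\<dots> = ?c *\<^sub>R (?Ci *v e)" by (simp add: Cmat_eigenvector[OF e] matrix_vector_mult_scaleR)
  finally have "(1 / ?c) *\<^sub>R e = (1 / ?c * ?c) *\<^sub>R (?Ci *v e)" by (metis scaleR_scaleR)
  then have Ci: "?Ci *v e = (1 / ?c) *\<^sub>R e" using c by simp
  have "Mmat \<alpha> B T *v e = ?Ci *v (matpow (mat 1 - \<alpha> *\<^sub>R B) T *v e)"
    by (simp add: Mmat_def matrix_vector_mul_assoc)
  also have "\<dots> = Mmat_eigenvalue \<alpha> T b *\<^sub>R e"
    by (simp add: matpow_eigenvector[OF step_matrix_eigenvector[OF e]] matrix_vector_mult_scaleR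
        Ci Mmat_eigenvalue_def)
  finally show ?thesis .
qed

lemma Mmat_eigenbasis:
  fixes B :: "real^'n^'n"
  assumes sym: "transpose B = B" and psd: "\<forall>v. 0 \<le> v \<bullet> (B *v v)"
    and \<alpha>: "0 < \<alpha>" "\<alpha> * rho B < 1" and T: "1 \<le> T"
  obtains E b where "orthonormal_basis E" "\<forall>e\<in>E. B *v e = b e *\<^sub>R e"
    "\<forall>e\<in>E. 0 \<le> b e \<and> b e \<le> rho B"
    "\<forall>e\<in>E. Mmat \<alpha> B T *v e = Mmat_eigenvalue \<alpha> T (b e) *\<^sub>R e"
proof -
  obtain E b where E: "orthonormal_basis E" and Be: "\<forall>e\<in>E. B *v e = b e *\<^sub>R e"
    using symmetric_matrix_orthonormal_eigenbasis[OF sym] by blast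
  have b_bounds: "0 \<le> b e \<and> b e \<le> rho B" if "e \<in> E" for e
  proof
    have "b e = e \<bullet> (B *v e)" using Be that orthonormal_basis_inner_self[OF E that] by simp
    then show "0 \<le> b e" using psd by simp
    show "b e \<le> rho B" using Be that orthonormal_basis_inner_self[OF E that]
      by (intro eigenvalue_le_rho[OF sym, of e]) auto
  qed
  have c_pos: "0 < (\<Sum>t<T. (1 - \<alpha> * b e) ^ t)" if "e \<in> E" for e
  proof (rule geometric_sum_pos[OF _ T])
    have "\<alpha> * b e \<le> \<alpha> * rho B" using b_bounds[OF that] \<alpha>(1) by simp
    then show "0 < 1 - \<alpha> * b e" using \<alpha>(2) by linarith
  qed
  then have c_nonzero: "(\<Sum>t<T. (1 - \<alpha> * b e) ^ t) \<noteq> 0" if "e \<in> E" for e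
    using that by (metis less_irrefl)
  have "invertible (Cmat \<alpha> B T)"
    by (rule orthonormal_eigenbasis_invertible[OF E, of _ "\<lambda>e. \<Sum>t<T. (1 - \<alpha> * b e) ^ t"])
      (use c_nonzero Be in \<open>auto simp: Cmat_eigenvector\<close>)
  then have "\<forall>e\<in>E. Mmat \<alpha> B T *v e = Mmat_eigenvalue \<alpha> T (b e) *\<^sub>R e"
    using Be c_nonzero by (auto intro: Mmat_eigenvector)
  with E Be b_bounds that show ?thesis by blast
qed

lemma Mmat_symmetric:
  fixes B :: "real^'n^'n"
  assumes "transpose B = B" "\<forall>v. 0 \<le> v \<bullet> (B *v v)" "0 < \<alpha>" "\<alpha> * rho B < 1" "1 \<le> T"
  shows "transpose (Mmat \<alpha> B T) = Mmat \<alpha> B T"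
proof -
  obtain E b where E: "orthonormal_basis E"
    and M: "\<forall>e\<in>E. Mmat \<alpha> B T *v e = Mmat_eigenvalue \<alpha> T (b e) *\<^sub>R e"
    using Mmat_eigenbasis[OF assms] by metis
  have "transpose (Mmat \<alpha> B T) *v v = Mmat \<alpha> B T *v v" for v
  proof (rule orthonormal_basis_eq[OF E], rule ballI)
    fix e assume "e \<in> E"
    have "(transpose (Mmat \<alpha> B T) *v v) \<bullet> e = v \<bullet> (Mmat \<alpha> B T *v e)"
      by (metis inner_matrix_vector_transpose transpose_transpose)
    also have "\<dots> = (Mmat \<alpha> B T *v v) \<bullet> e"
      using M \<open>e \<in> E\<close> orthonormal_eigenbasis_coord[OF E M \<open>e \<in> E\<close>, of v] by simp
    finally show "(transpose (Mmat \<alpha> B T) *v v) \<bullet> e = (Mmat \<alpha> B T *v v) \<bullet> e" .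
  qed
  then show ?thesis by (simp add: matrix_eq)
qed

lemma Mmat_quadratic_form_gt:
  fixes B :: "real^'n^'n"
  assumes sym: "transpose B = B" and psd: "\<forall>v. 0 \<le> v \<bullet> (B *v v)"
    and "0 < \<alpha>" "1 \<le> T" "0 < L" "0 < \<eta>"
    and \<alpha>_bound: "\<alpha> < (1 - (L\<^sup>2 / (L\<^sup>2 + \<eta> * rho B)) powr (1 / real T)) / rho B"
  obtains \<kappa> where "\<alpha> * L\<^sup>2 / \<eta> < \<kappa>" "\<forall>v. \<kappa> * (v \<bullet> v) \<le> v \<bullet> (Mmat \<alpha> B T *v v)"
proof -
  note \<rho> = stepsize_bound_rho[OF \<open>0 < \<alpha>\<close> rho_nonneg[OF sym psd] \<alpha>_bound]
  obtain E b where E: "orthonormal_basis E" and b: "\<forall>e\<in>E. 0 \<le> b e \<and> b e \<le> rho B"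
    and M: "\<forall>e\<in>E. Mmat \<alpha> B T *v e = Mmat_eigenvalue \<alpha> T (b e) *\<^sub>R e"
    using Mmat_eigenbasis[OF sym psd \<open>0 < \<alpha>\<close> \<rho>(2) \<open>1 \<le> T\<close>] by metis
  have "\<forall>e\<in>E. \<alpha> * L\<^sup>2 / \<eta> < Mmat_eigenvalue \<alpha> T (b e)"
    using b assms by (blast intro: Mmat_eigenvalue_gt[OF _ \<rho>(1)])
  then show ?thesis using orthonormal_eigenbasis_quadratic_form_gt[OF E M] that by blast
qed

section \<open>One outer iteration of FlexPD-C\<close>

lemma flex_inner_eigen_coord:
  fixes B :: "real^'n^'n"
  assumes sym: "transpose B = B" and e: "B *v e = b *\<^sub>R e"
  shows "flex_inner \<alpha> A B df x l t \<bullet> e = (1 - \<alpha> * b) ^ t * (x \<bullet> e)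
           - \<alpha> * (\<Sum>s<t. (1 - \<alpha> * b) ^ s) * ((grad df x + transpose A *v l) \<bullet> e)"
proof (induction t)
  case (Suc t)
  let ?w = "1 - \<alpha> * b" and ?g = "(grad df x + transpose A *v l) \<bullet> e"
    and ?x = "flex_inner \<alpha> A B df x l t"
  have "flex_inner \<alpha> A B df x l (Suc t) \<bullet> e = ?w * (?x \<bullet> e) - \<alpha> * ?g"
    using symmetric_matrix_inner[OF sym, of ?x e] e
    by (simp add: inner_diff_left inner_add_left algebra_simps)
  also have "\<dots> = ?w ^ Suc t * (x \<bullet> e) - \<alpha> * (1 + ?w * (\<Sum>s<t. ?w ^ s)) * ?g"
    unfolding Suc by (simp add: algebra_simps)
  also have "1 + ?w * (\<Sum>s<t. ?w ^ s) = (\<Sum>s<Suc t. ?w ^ s)"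
    by (subst sum.lessThan_Suc_shift) (simp add: sum_distrib_left)
  finally show ?case .
qed simp

lemma flex_inner_identity:
  fixes B :: "real^'n^'n" and A :: "real^'n^'e" and df :: "'n \<Rightarrow> real \<Rightarrow> real"
    and x :: "real^'n" and l :: "real^'e"
  assumes sym: "transpose B = B" and psd: "\<forall>v. 0 \<le> v \<bullet> (B *v v)"
    and \<alpha>: "0 < \<alpha>" "\<alpha> * rho B < 1" and T: "1 \<le> T"
  defines "x' \<equiv> flex_inner \<alpha> A B df x l T"
  shows "Mmat \<alpha> B T *v (x' - x) + \<alpha> *\<^sub>R (B *v x') + \<alpha> *\<^sub>R (grad df x + transpose A *v l) = 0"
proof -
  obtain E b where E: "orthonormal_basis E" and B: "\<forall>e\<in>E. B *v e = b e *\<^sub>R e"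
    and b: "\<forall>e\<in>E. 0 \<le> b e \<and> b e \<le> rho B"
    and M: "\<forall>e\<in>E. Mmat \<alpha> B T *v e = Mmat_eigenvalue \<alpha> T (b e) *\<^sub>R e"
    using Mmat_eigenbasis[OF sym psd \<alpha> T] by metis
  show ?thesis
  proof (rule orthonormal_basis_eq_0[OF E], rule ballI)
    fix e assume e: "e \<in> E"
    define w where "w = 1 - \<alpha> * b e"
    define c where "c = (\<Sum>t<T. w ^ t)"
    define g where "g = (grad df x + transpose A *v l) \<bullet> e"
    have "\<alpha> * b e \<le> \<alpha> * rho B" using b e \<alpha>(1) by simp
    then have "0 < c" unfolding c_def using \<alpha>(2) T by (intro geometric_sum_pos) (auto simp: w_def)
    \<comment> \<open>\<open>c_M\<close> and \<open>geometric\<close> say that \<open>M + \<alpha> B = C\<^sup>-\<^sup>1\<close> on the eigenvector \<open>e\<close>\<close>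
    then have c_M: "c * Mmat_eigenvalue \<alpha> T (b e) = w ^ T"
      by (simp add: Mmat_eigenvalue_def c_def w_def)
    have geometric: "\<alpha> * b e * c = 1 - w ^ T"
      using one_diff_power_eq[of w T] by (simp add: c_def w_def mult.commute)
    have x': "x' \<bullet> e = w ^ T * (x \<bullet> e) - \<alpha> * c * g"
      unfolding x'_def c_def w_def g_def using flex_inner_eigen_coord[OF sym] B e by blast
    have "(Mmat \<alpha> B T *v (x' - x) + \<alpha> *\<^sub>R (B *v x') + \<alpha> *\<^sub>R (grad df x + transpose A *v l)) \<bullet> e
        = Mmat_eigenvalue \<alpha> T (b e) * (x' \<bullet> e - x \<bullet> e) + \<alpha> * b e * (x' \<bullet> e) + \<alpha> * g"
      using orthonormal_eigenbasis_coord[OF E M e] orthonormal_eigenbasis_coord[OF E B e]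
      by (simp add: g_def inner_add_left inner_diff_left)
    also have "\<dots> = (c * Mmat_eigenvalue \<alpha> T (b e) * (x' \<bullet> e - x \<bullet> e)
        + \<alpha> * b e * c * (x' \<bullet> e) + \<alpha> * c * g) / c"
      using \<open>0 < c\<close> by (simp add: field_simps)
    also have "\<dots> = (w ^ T * (x' \<bullet> e - x \<bullet> e) + (1 - w ^ T) * (x' \<bullet> e) + \<alpha> * c * g) / c"
      unfolding c_M geometric ..
    also have "\<dots> = 0" unfolding x' by (simp add: algebra_simps)
    finally show "(Mmat \<alpha> B T *v (x' - x) + \<alpha> *\<^sub>R (B *v x')
        + \<alpha> *\<^sub>R (grad df x + transpose A *v l)) \<bullet> e = 0" .
  qed
qed

lemma flex_inner_error_identity:
  fixes B :: "real^'n^'n" and A :: "real^'n^'e" and df :: "'n \<Rightarrow> real \<Rightarrow> real"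
    and x :: "real^'n" and l :: "real^'e"
  assumes "transpose B = B" "\<forall>v. 0 \<le> v \<bullet> (B *v v)" "0 < \<alpha>" "\<alpha> * rho B < 1" "1 \<le> T"
    and "B *v xs = 0" and "grad df xs + transpose A *v ls = 0"
  defines "x' \<equiv> flex_inner \<alpha> A B df x l T"
  shows "Mmat \<alpha> B T *v (x' - xs - (x - xs)) + \<alpha> *\<^sub>R (B *v (x' - xs))
           + \<alpha> *\<^sub>R ((grad df x - grad df xs) + transpose A *v (l - ls)) = 0"
proof -
  have B_eq: "B *v (x' - xs) = B *v x'" using assms(6) by (simp add: matrix_vector_mult_diff_distrib)
  have "(grad df x - grad df xs) + transpose A *v (l - ls)
      = (grad df x + transpose A *v l) - (grad df xs + transpose A *v ls)"
    by (simp add: matrix_vector_mult_diff_distrib algebra_simps del: transpose_matrix_vector)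
  also have "\<dots> = grad df x + transpose A *v l" using assms(7) by simp
  finally have g_eq: "(grad df x - grad df xs) + transpose A *v (l - ls) = grad df x + transpose A *v l" .
  have x_eq: "x' - xs - (x - xs) = x' - x" by simp
  show ?thesis unfolding x_eq B_eq g_eq unfolding x'_def by (rule flex_inner_identity[OF assms(1-5)])
qed

section \<open>Contraction of the primal-dual error\<close>

definition diagonal_slope :: "real \<Rightarrow> real \<Rightarrow> real^'n \<Rightarrow> real^'n \<Rightarrow> bool" where
  "diagonal_slope m L d e \<longleftrightarrow> (\<forall>i. \<exists>h. m \<le> h \<and> h \<le> L \<and> d$i = h * e$i)"

lemma mvt_bounded_slope:
  fixes g g' :: "real \<Rightarrow> real"
  assumes der: "\<And>t. (g has_real_derivative g' t) (at t)" and bnd: "\<And>t. m \<le> g' t \<and> g' t \<le> L"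
  shows "\<exists>h. m \<le> h \<and> h \<le> L \<and> g a - g b = h * (a - b)"
proof (cases a b rule: linorder_cases)
  case less
  then obtain z where "g b - g a = (b - a) * g' z" using MVT2[OF less] der by metis
  then show ?thesis using bnd[of z] by (metis minus_diff_eq mult.commute mult_minus_left)
next
  case equal
  then show ?thesis using bnd[of a] by auto
next
  case greater
  then obtain z where "g a - g b = (a - b) * g' z" using MVT2[OF greater] der by metis
  then show ?thesis using bnd[of z] by (metis mult.commute)
qed

lemma grad_diff_diagonal_slope:
  assumes "\<And>i t. (df i has_real_derivative d2f i t) (at t)"
    and "\<And>i t. m \<le> d2f i t \<and> d2f i t \<le> L"
  shows "diagonal_slope m L (grad df x - grad df y) (x - y)"
proof -
  have "\<exists>h. m \<le> h \<and> h \<le> L \<and> df i (x$i) - df i (y$i) = h * (x$i - y$i)" for i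
    by (rule mvt_bounded_slope) (use assms in auto)
  then show ?thesis unfolding diagonal_slope_def grad_def by simp
qed

lemma diagonal_slope_pos: "diagonal_slope m L d e \<Longrightarrow> 0 < m \<Longrightarrow> 0 < L"
  unfolding diagonal_slope_def by (meson less_le_trans)

lemma diagonal_slope_norm_le:
  assumes slope: "diagonal_slope m L d e" and "0 < m"
  shows "norm d \<le> L * norm e"
proof -
  have "0 \<le> L" using diagonal_slope_pos[OF slope \<open>0 < m\<close>] by simp
  have coord: "(d$i)\<^sup>2 \<le> L\<^sup>2 * (e$i)\<^sup>2" for i
  proof -
    obtain h where h: "m \<le> h" "h \<le> L" "d$i = h * e$i" using slope unfolding diagonal_slope_def by blast
    have "h\<^sup>2 \<le> L\<^sup>2" using h \<open>0 < m\<close> by (intro power_mono) auto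
    then show ?thesis using h(3) by (simp add: power_mult_distrib mult_right_mono)
  qed
  have sq: "(norm v)\<^sup>2 = (\<Sum>i\<in>UNIV. (v$i)\<^sup>2)" for v :: "real^'n"
    by (simp only: power2_norm_eq_inner) (simp add: inner_vec_def power2_eq_square)
  have "(norm d)\<^sup>2 \<le> (\<Sum>i\<in>UNIV. L\<^sup>2 * (e$i)\<^sup>2)" unfolding sq by (rule sum_mono) (rule coord)
  also have "\<dots> = L\<^sup>2 * (norm e)\<^sup>2" unfolding sq by (rule sum_distrib_left[symmetric])
  also have "\<dots> = (L * norm e)\<^sup>2" by (rule power_mult_distrib[symmetric])
  finally show ?thesis by (rule power2_le_imp_le) (use \<open>0 \<le> L\<close> in simp)
qed

lemma slope_young_inequality:
  fixes m h L \<eta> y u :: real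
  assumes "m \<le> h" "h \<le> L" "0 < m" "0 < \<eta>"
  shows "(2 * m - \<eta>) * y\<^sup>2 - (L\<^sup>2 / \<eta>) * u\<^sup>2 \<le> 2 * y * (h * (y - u))"
proof -
  have "2 * h * y * u * \<eta> \<le> \<eta> * (\<eta> * y\<^sup>2) + h\<^sup>2 * u\<^sup>2"
    using zero_le_power2[of "\<eta> * y - h * u"] by (simp add: power2_eq_square algebra_simps)
  also have "h\<^sup>2 * u\<^sup>2 \<le> L\<^sup>2 * u\<^sup>2"
    using assms by (intro mult_right_mono power_mono) auto
  finally have "2 * h * y * u \<le> \<eta> * y\<^sup>2 + (L\<^sup>2 / \<eta>) * u\<^sup>2"
    using \<open>0 < \<eta>\<close> by (simp add: field_simps)
  moreover have "2 * m * y\<^sup>2 \<le> 2 * h * y\<^sup>2" using assms(1) by (simp add: mult_right_mono)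
  ultimately show ?thesis by (simp add: algebra_simps power2_eq_square)
qed

lemma diagonal_slope_inner_ge:
  assumes slope: "diagonal_slope m L d e0" and "0 < m" "0 < \<eta>"
  shows "(2 * m - \<eta>) * (e1 \<bullet> e1) - (L\<^sup>2 / \<eta>) * ((e1 - e0) \<bullet> (e1 - e0)) \<le> 2 * (e1 \<bullet> d)"
proof -
  have coord: "(2 * m - \<eta>) * (e1$i)\<^sup>2 - (L\<^sup>2 / \<eta>) * ((e1 - e0)$i)\<^sup>2 \<le> 2 * (e1$i * d$i)" for i
  proof -
    obtain h where h: "m \<le> h" "h \<le> L" "d$i = h * e0$i" using slope unfolding diagonal_slope_def by blast
    then show ?thesis
      using slope_young_inequality[OF h(1,2) assms(2,3), of "e1$i" "(e1 - e0)$i"] by simp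
  qed
  have "(2 * m - \<eta>) * (e1 \<bullet> e1) - (L\<^sup>2 / \<eta>) * ((e1 - e0) \<bullet> (e1 - e0))
      = (\<Sum>i\<in>UNIV. (2 * m - \<eta>) * (e1$i)\<^sup>2 - (L\<^sup>2 / \<eta>) * ((e1 - e0)$i)\<^sup>2)"
    by (simp add: inner_vec_def sum_subtractf sum_distrib_left power2_eq_square)
  also have "\<dots> \<le> (\<Sum>i\<in>UNIV. 2 * (e1$i * d$i))" by (rule sum_mono) (rule coord)
  also have "\<dots> = 2 * (e1 \<bullet> d)" by (simp add: inner_vec_def sum_distrib_left)
  finally show ?thesis .
qed

lemma primal_dual_energy_identity:
  fixes M B :: "real^'n^'n" and A :: "real^'n^'e"
  assumes step: "M *v (e1 - e0) + \<alpha> *\<^sub>R (B *v e1) + \<alpha> *\<^sub>R (d + transpose A *v \<mu>0) = 0"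
    and dual: "\<mu>1 = \<mu>0 + \<beta> *\<^sub>R (A *v e1)" and M_sym: "transpose M = M" and "0 < \<beta>"
  shows "(e1 \<bullet> (M *v e1) + (\<alpha> / \<beta>) * (\<mu>1 \<bullet> \<mu>1)) - (e0 \<bullet> (M *v e0) + (\<alpha> / \<beta>) * (\<mu>0 \<bullet> \<mu>0))
       = - ((e1 - e0) \<bullet> (M *v (e1 - e0))) - 2 * \<alpha> * (e1 \<bullet> (B *v e1))
         + \<alpha> * \<beta> * ((A *v e1) \<bullet> (A *v e1)) - 2 * \<alpha> * (e1 \<bullet> d)"
proof -
  define u where "u = e1 - e0"
  have "e1 \<bullet> (M *v u + \<alpha> *\<^sub>R (B *v e1) + \<alpha> *\<^sub>R (d + transpose A *v \<mu>0)) = 0"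
    using step by (simp add: u_def)
  then have step_e1: "e1 \<bullet> (M *v u) + \<alpha> * (e1 \<bullet> (B *v e1)) + \<alpha> * (e1 \<bullet> d) + \<alpha> * ((A *v e1) \<bullet> \<mu>0) = 0"
    by (simp add: inner_add_right inner_matrix_vector_transpose algebra_simps
        del: transpose_matrix_vector)
  have "e0 \<bullet> (M *v e0) = e1 \<bullet> (M *v e1) - 2 * (e1 \<bullet> (M *v u)) + u \<bullet> (M *v u)"
    using symmetric_matrix_inner[OF M_sym, of u e1]
    by (simp add: u_def matrix_vector_mult_diff_distrib inner_diff_left inner_diff_right inner_commute)
  moreover have "(\<alpha> / \<beta>) * (\<mu>1 \<bullet> \<mu>1) - (\<alpha> / \<beta>) * (\<mu>0 \<bullet> \<mu>0)
      = 2 * \<alpha> * ((A *v e1) \<bullet> \<mu>0) + \<alpha> * \<beta> * ((A *v e1) \<bullet> (A *v e1))"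
    using \<open>0 < \<beta>\<close>
    by (simp add: dual inner_add_left inner_add_right inner_commute field_simps power2_eq_square)
  ultimately show ?thesis using step_e1 unfolding u_def by (simp add: algebra_simps)
qed

lemma primal_dual_descent:
  fixes M B :: "real^'n^'n" and A :: "real^'n^'e"
  assumes step: "M *v (e1 - e0) + \<alpha> *\<^sub>R (B *v e1) + \<alpha> *\<^sub>R (d + transpose A *v \<mu>0) = 0"
    and dual: "\<mu>1 = \<mu>0 + \<beta> *\<^sub>R (A *v e1)"
    and M_sym: "transpose M = M" and M_ge: "\<forall>v. \<kappa> * (v \<bullet> v) \<le> v \<bullet> (M *v v)"
    and B_psd: "\<forall>v. 0 \<le> v \<bullet> (B *v v)" and slope: "diagonal_slope m L d e0"
    and "0 < \<alpha>" "0 < \<beta>" "0 < m" "0 < \<eta>"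
  shows "(\<kappa> - \<alpha> * L\<^sup>2 / \<eta>) * ((e1 - e0) \<bullet> (e1 - e0))
           + \<alpha> * (2 * m - \<eta> - \<beta> * rho (transpose A ** A)) * (e1 \<bullet> e1)
         \<le> (e0 \<bullet> (M *v e0) + (\<alpha> / \<beta>) * (\<mu>0 \<bullet> \<mu>0)) - (e1 \<bullet> (M *v e1) + (\<alpha> / \<beta>) * (\<mu>1 \<bullet> \<mu>1))"
proof -
  let ?u = "e1 - e0" and ?\<rho> = "rho (transpose A ** A)"
  have "(A *v e1) \<bullet> (A *v e1) = e1 \<bullet> ((transpose A ** A) *v e1)"
    by (simp add: inner_matrix_vector_transpose matrix_vector_mul_assoc)
  also have "\<dots> \<le> ?\<rho> * (e1 \<bullet> e1)"
    by (rule quadratic_form_le_rho) (simp add: matrix_transpose_mul)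
  finally have A_term: "\<alpha> * \<beta> * ((A *v e1) \<bullet> (A *v e1)) \<le> \<alpha> * \<beta> * (?\<rho> * (e1 \<bullet> e1))"
    using \<open>0 < \<alpha>\<close> \<open>0 < \<beta>\<close> by simp
  have d_term: "\<alpha> * ((2 * m - \<eta>) * (e1 \<bullet> e1) - (L\<^sup>2 / \<eta>) * (?u \<bullet> ?u)) \<le> 2 * \<alpha> * (e1 \<bullet> d)"
    using diagonal_slope_inner_ge[OF slope \<open>0 < m\<close> \<open>0 < \<eta>\<close>] \<open>0 < \<alpha>\<close> by simp
  have M_term: "\<kappa> * (?u \<bullet> ?u) \<le> ?u \<bullet> (M *v ?u)" and B_term: "0 \<le> 2 * \<alpha> * (e1 \<bullet> (B *v e1))"
    using M_ge B_psd \<open>0 < \<alpha>\<close> by simp_all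
  have "(\<kappa> - \<alpha> * L\<^sup>2 / \<eta>) * (?u \<bullet> ?u) + \<alpha> * (2 * m - \<eta> - \<beta> * ?\<rho>) * (e1 \<bullet> e1)
      = \<kappa> * (?u \<bullet> ?u) + \<alpha> * ((2 * m - \<eta>) * (e1 \<bullet> e1) - (L\<^sup>2 / \<eta>) * (?u \<bullet> ?u))
        - \<alpha> * \<beta> * (?\<rho> * (e1 \<bullet> e1))"
    by (simp add: algebra_simps)
  then show ?thesis
    using primal_dual_energy_identity[OF step dual M_sym \<open>0 < \<beta>\<close>] A_term d_term M_term B_term
    by linarith
qed

lemma transpose_bounded_below_on_range:
  fixes A :: "real^'n^'e"
  obtains \<sigma> where "0 < \<sigma>" "\<forall>\<mu>\<in>range ((*v) A). \<sigma> * norm \<mu> \<le> norm (transpose A *v \<mu>)"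
proof -
  have sub: "subspace (range ((*v) A))"
    by (rule linear_subspace_image) (simp_all add: matrix_vector_mul_linear)
  have "\<forall>\<mu>\<in>range ((*v) A). transpose A *v \<mu> = 0 \<longrightarrow> \<mu> = 0"
  proof (intro ballI impI)
    fix \<mu> assume "\<mu> \<in> range ((*v) A)" and "transpose A *v \<mu> = 0"
    moreover obtain v where "\<mu> = A *v v" using \<open>\<mu> \<in> range ((*v) A)\<close> by blast
    ultimately have "\<mu> \<bullet> \<mu> = 0" by (simp add: inner_matrix_vector_transpose del: transpose_matrix_vector)
    then show "\<mu> = 0" by simp
  qed
  then show ?thesis
    using injective_imp_isometric[OF closed_subspace[OF sub] sub, of "(*v) (transpose A)"] that
    by auto
qed

lemma dual_residual_norm_le:
  fixes M B :: "real^'n^'n" and A :: "real^'n^'e"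
  assumes step: "M *v (e1 - e0) + \<alpha> *\<^sub>R (B *v e1) + \<alpha> *\<^sub>R (d + transpose A *v \<mu>0) = 0"
    and dual: "\<mu>1 = \<mu>0 + \<beta> *\<^sub>R (A *v e1)" and slope: "diagonal_slope m L d e0"
    and "0 < m" "0 \<le> \<alpha>" "0 \<le> \<beta>"
    and KM: "\<forall>v. norm (M *v v) \<le> KM * norm v" "0 \<le> KM"
    and KB: "\<forall>v. norm (B *v v) \<le> KB * norm v" "0 \<le> KB"
    and KA: "\<forall>v. norm ((transpose A ** A) *v v) \<le> KA * norm v" "0 \<le> KA"
  shows "\<alpha> * norm (transpose A *v \<mu>1)
           \<le> (KM + \<alpha> * (KB + 2 * L + \<beta> * KA)) * sqrt ((e1 - e0) \<bullet> (e1 - e0) + e1 \<bullet> e1)"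
proof -
  define N where "N = sqrt ((e1 - e0) \<bullet> (e1 - e0) + e1 \<bullet> e1)"
  have N: "norm (e1 - e0) \<le> N" "norm e1 \<le> N"
    unfolding N_def norm_eq_sqrt_inner by (simp_all add: real_sqrt_le_mono)
  then have "norm e0 \<le> 2 * N" using norm_triangle_ineq4[of e1 "e1 - e0"] by simp
  then have d: "norm d \<le> L * (2 * N)"
    using diagonal_slope_norm_le[OF slope \<open>0 < m\<close>] diagonal_slope_pos[OF slope \<open>0 < m\<close>]
    by (meson less_imp_le mult_left_mono order_trans)
  have "\<alpha> *\<^sub>R (transpose A *v \<mu>1) = - (M *v (e1 - e0)) - \<alpha> *\<^sub>R (B *v e1) - \<alpha> *\<^sub>R d
      + (\<alpha> * \<beta>) *\<^sub>R ((transpose A ** A) *v e1)"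
    using step unfolding dual
    by (simp add: matrix_vector_right_distrib matrix_vector_mult_scaleR matrix_vector_mul_assoc
        algebra_simps eq_neg_iff_add_eq_0 del: transpose_matrix_vector)
  then have "\<alpha> * norm (transpose A *v \<mu>1) = norm (- (M *v (e1 - e0)) - \<alpha> *\<^sub>R (B *v e1) - \<alpha> *\<^sub>R d
      + (\<alpha> * \<beta>) *\<^sub>R ((transpose A ** A) *v e1))"
    using \<open>0 \<le> \<alpha>\<close> by (metis norm_scaleR abs_of_nonneg)
  also have "\<dots> \<le> norm (M *v (e1 - e0)) + \<alpha> * norm (B *v e1) + \<alpha> * norm d
      + \<alpha> * \<beta> * norm ((transpose A ** A) *v e1)"
    using \<open>0 \<le> \<alpha>\<close> \<open>0 \<le> \<beta>\<close>
    by (smt (verit) norm_minus_cancel norm_scaleR norm_triangle_ineq norm_triangle_ineq4 abs_of_nonneg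
        mult_nonneg_nonneg)
  also have "\<dots> \<le> KM * N + \<alpha> * (KB * N) + \<alpha> * (L * (2 * N)) + \<alpha> * \<beta> * (KA * N)"
  proof -
    have "norm (M *v (e1 - e0)) \<le> KM * N" using KM N(1) by (meson mult_left_mono order_trans)
    moreover have "norm (B *v e1) \<le> KB * N" using KB N(2) by (meson mult_left_mono order_trans)
    moreover have "norm ((transpose A ** A) *v e1) \<le> KA * N" using KA N(2) by (meson mult_left_mono order_trans)
    ultimately show ?thesis
      using d \<open>0 \<le> \<alpha>\<close> \<open>0 \<le> \<beta>\<close> by (intro add_mono mult_left_mono) simp_all
  qed
  also have "\<dots> = (KM + \<alpha> * (KB + 2 * L + \<beta> * KA)) * N" by (simp add: algebra_simps)
  finally show ?thesis unfolding N_def .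
qed

lemma primal_dual_energy_bound:
  fixes M B :: "real^'n^'n" and A :: "real^'n^'e"
  assumes "0 < \<alpha>" "0 < \<beta>" "0 < m" "m \<le> L"
  obtains K where "0 < K"
    "\<forall>e0 e1 d \<mu>0 \<mu>1. M *v (e1 - e0) + \<alpha> *\<^sub>R (B *v e1) + \<alpha> *\<^sub>R (d + transpose A *v \<mu>0) = 0 \<longrightarrow>
       \<mu>1 = \<mu>0 + \<beta> *\<^sub>R (A *v e1) \<longrightarrow> \<mu>1 \<in> range ((*v) A) \<longrightarrow> diagonal_slope m L d e0 \<longrightarrow>
       e1 \<bullet> (M *v e1) + (\<alpha> / \<beta>) * (\<mu>1 \<bullet> \<mu>1) \<le> K * ((e1 - e0) \<bullet> (e1 - e0) + e1 \<bullet> e1)"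
proof -
  obtain \<sigma> where \<sigma>: "0 < \<sigma>" "\<forall>\<mu>\<in>range ((*v) A). \<sigma> * norm \<mu> \<le> norm (transpose A *v \<mu>)"
    using transpose_bounded_below_on_range by blast
  define KM where "KM = onorm ((*v) M)"
  define KB where "KB = onorm ((*v) B)"
  define KA where "KA = onorm ((*v) (transpose A ** A))"
  have K_bounds: "\<forall>v. norm (M *v v) \<le> KM * norm v" "0 \<le> KM" "\<forall>v. norm (B *v v) \<le> KB * norm v" "0 \<le> KB"
    "\<forall>v. norm ((transpose A ** A) *v v) \<le> KA * norm v" "0 \<le> KA"
    unfolding KM_def KB_def KA_def by (simp_all add: onorm onorm_pos_le)
  define R where "R = KM + \<alpha> * (KB + 2 * L + \<beta> * KA)"
  have "0 < R" using assms K_bounds unfolding R_def by (simp add: add_nonneg_pos add_pos_nonneg)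
  have bound: "e1 \<bullet> (M *v e1) + (\<alpha> / \<beta>) * (\<mu>1 \<bullet> \<mu>1)
      \<le> (KM + R\<^sup>2 / (\<alpha> * \<beta> * \<sigma>\<^sup>2)) * ((e1 - e0) \<bullet> (e1 - e0) + e1 \<bullet> e1)"
    if step: "M *v (e1 - e0) + \<alpha> *\<^sub>R (B *v e1) + \<alpha> *\<^sub>R (d + transpose A *v \<mu>0) = 0"
      and dual: "\<mu>1 = \<mu>0 + \<beta> *\<^sub>R (A *v e1)" and "\<mu>1 \<in> range ((*v) A)"
      and slope: "diagonal_slope m L d e0" for e0 e1 d \<mu>0 \<mu>1
  proof -
    define N2 where "N2 = (e1 - e0) \<bullet> (e1 - e0) + e1 \<bullet> e1"
    have "\<sigma> * norm \<mu>1 \<le> norm (transpose A *v \<mu>1)" using \<sigma>(2) \<open>\<mu>1 \<in> range ((*v) A)\<close> by blast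
    then have "(\<alpha> * \<sigma>) * norm \<mu>1 \<le> \<alpha> * norm (transpose A *v \<mu>1)"
      using \<open>0 < \<alpha>\<close> by (simp add: mult.assoc)
    also have "\<dots> \<le> R * sqrt N2"
      unfolding R_def N2_def using assms K_bounds
      by (intro dual_residual_norm_le[OF step dual slope]) simp_all
    finally have "((\<alpha> * \<sigma>) * norm \<mu>1)\<^sup>2 \<le> (R * sqrt N2)\<^sup>2"
      using assms \<sigma>(1) by (intro power_mono) simp_all
    moreover have "0 \<le> N2" by (simp add: N2_def)
    ultimately have "(\<alpha> * \<sigma>)\<^sup>2 * (\<mu>1 \<bullet> \<mu>1) \<le> R\<^sup>2 * N2"
      by (simp add: power_mult_distrib power2_norm_eq_inner)
    then have "(\<alpha> / \<beta>) * (\<mu>1 \<bullet> \<mu>1) \<le> R\<^sup>2 / (\<alpha> * \<beta> * \<sigma>\<^sup>2) * N2"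
      using assms \<sigma>(1) by (simp add: field_simps power2_eq_square)
    moreover have "e1 \<bullet> (M *v e1) \<le> KM * N2"
    proof -
      have "e1 \<bullet> (M *v e1) \<le> norm e1 * (KM * norm e1)"
        using norm_cauchy_schwarz[of e1 "M *v e1"] K_bounds(1)
        by (meson mult_left_mono norm_ge_zero order_trans)
      also have "\<dots> = KM * (e1 \<bullet> e1)" by (simp add: power2_norm_eq_inner[symmetric] power2_eq_square)
      also have "\<dots> \<le> KM * N2" using K_bounds(2) by (simp add: N2_def mult_left_mono)
      finally show ?thesis .
    qed
    ultimately show ?thesis unfolding N2_def by (simp add: algebra_simps)
  qed
  show ?thesis
  proof (rule that)
    show "0 < KM + R\<^sup>2 / (\<alpha> * \<beta> * \<sigma>\<^sup>2)"
      using \<open>0 < R\<close> assms \<sigma>(1) K_bounds(2) by (simp add: add_nonneg_pos)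
  qed (use bound in blast)
qed

lemma descent_imp_contraction:
  fixes \<epsilon> K N G\<^sub>0 G\<^sub>1 :: real
  assumes "0 < \<epsilon>" "0 < K" "\<epsilon> * N \<le> G\<^sub>0 - G\<^sub>1" "G\<^sub>1 \<le> K * N"
  shows "G\<^sub>1 \<le> 1 / (1 + \<epsilon> / K) * G\<^sub>0"
proof -
  have "\<epsilon> / K * G\<^sub>1 \<le> \<epsilon> * N" using assms by (simp add: field_simps mult_left_mono)
  then have "(1 + \<epsilon> / K) * G\<^sub>1 \<le> G\<^sub>0" using assms(3) by (simp add: algebra_simps)
  then show ?thesis using assms(1,2) by (simp add: field_simps add_pos_pos)
qed

lemma primal_dual_contraction:
  fixes M B :: "real^'n^'n" and A :: "real^'n^'e"
  assumes M_sym: "transpose M = M" and M_ge: "\<forall>v. \<kappa> * (v \<bullet> v) \<le> v \<bullet> (M *v v)"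
    and \<kappa>: "\<alpha> * L\<^sup>2 / \<eta> < \<kappa>" and B_psd: "\<forall>v. 0 \<le> v \<bullet> (B *v v)"
    and "0 < \<alpha>" "0 < \<beta>" "0 < m" "m \<le> L" "0 < \<eta>"
    and \<beta>_bound: "\<beta> * rho (transpose A ** A) < 2 * m - \<eta>"
  obtains \<delta> where "0 < \<delta>"
    "\<forall>e0 e1 d \<mu>0 \<mu>1. M *v (e1 - e0) + \<alpha> *\<^sub>R (B *v e1) + \<alpha> *\<^sub>R (d + transpose A *v \<mu>0) = 0 \<longrightarrow>
       \<mu>1 = \<mu>0 + \<beta> *\<^sub>R (A *v e1) \<longrightarrow> \<mu>1 \<in> range ((*v) A) \<longrightarrow> diagonal_slope m L d e0 \<longrightarrow>
       e1 \<bullet> (M *v e1) + (\<alpha> / \<beta>) * (\<mu>1 \<bullet> \<mu>1)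
         \<le> 1 / (1 + \<delta>) * (e0 \<bullet> (M *v e0) + (\<alpha> / \<beta>) * (\<mu>0 \<bullet> \<mu>0))"
proof -
  obtain K where "0 < K" and bound:
    "\<forall>e0 e1 d \<mu>0 \<mu>1. M *v (e1 - e0) + \<alpha> *\<^sub>R (B *v e1) + \<alpha> *\<^sub>R (d + transpose A *v \<mu>0) = 0 \<longrightarrow>
       \<mu>1 = \<mu>0 + \<beta> *\<^sub>R (A *v e1) \<longrightarrow> \<mu>1 \<in> range ((*v) A) \<longrightarrow> diagonal_slope m L d e0 \<longrightarrow>
       e1 \<bullet> (M *v e1) + (\<alpha> / \<beta>) * (\<mu>1 \<bullet> \<mu>1) \<le> K * ((e1 - e0) \<bullet> (e1 - e0) + e1 \<bullet> e1)"
    using primal_dual_energy_bound[OF \<open>0 < \<alpha>\<close> \<open>0 < \<beta>\<close> \<open>0 < m\<close> \<open>m \<le> L\<close>] by blast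
  define \<epsilon> where "\<epsilon> = min (\<kappa> - \<alpha> * L\<^sup>2 / \<eta>) (\<alpha> * (2 * m - \<eta> - \<beta> * rho (transpose A ** A)))"
  have "0 < \<epsilon>" using \<kappa> \<beta>_bound \<open>0 < \<alpha>\<close> by (simp add: \<epsilon>_def)
  have contraction: "e1 \<bullet> (M *v e1) + (\<alpha> / \<beta>) * (\<mu>1 \<bullet> \<mu>1)
         \<le> 1 / (1 + \<epsilon> / K) * (e0 \<bullet> (M *v e0) + (\<alpha> / \<beta>) * (\<mu>0 \<bullet> \<mu>0))"
    if step: "M *v (e1 - e0) + \<alpha> *\<^sub>R (B *v e1) + \<alpha> *\<^sub>R (d + transpose A *v \<mu>0) = 0"
      and dual: "\<mu>1 = \<mu>0 + \<beta> *\<^sub>R (A *v e1)" and range: "\<mu>1 \<in> range ((*v) A)"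
      and slope: "diagonal_slope m L d e0" for e0 e1 d \<mu>0 \<mu>1
  proof (rule descent_imp_contraction[OF \<open>0 < \<epsilon>\<close> \<open>0 < K\<close>])
    have "\<epsilon> * ((e1 - e0) \<bullet> (e1 - e0) + e1 \<bullet> e1)
        \<le> (\<kappa> - \<alpha> * L\<^sup>2 / \<eta>) * ((e1 - e0) \<bullet> (e1 - e0))
          + \<alpha> * (2 * m - \<eta> - \<beta> * rho (transpose A ** A)) * (e1 \<bullet> e1)"
      unfolding distrib_left \<epsilon>_def by (intro add_mono mult_right_mono) auto
    also have "\<dots> \<le> (e0 \<bullet> (M *v e0) + (\<alpha> / \<beta>) * (\<mu>0 \<bullet> \<mu>0)) - (e1 \<bullet> (M *v e1) + (\<alpha> / \<beta>) * (\<mu>1 \<bullet> \<mu>1))"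
      using primal_dual_descent[OF step dual M_sym M_ge B_psd slope] assms by blast
    finally show "\<epsilon> * ((e1 - e0) \<bullet> (e1 - e0) + e1 \<bullet> e1)
        \<le> (e0 \<bullet> (M *v e0) + (\<alpha> / \<beta>) * (\<mu>0 \<bullet> \<mu>0)) - (e1 \<bullet> (M *v e1) + (\<alpha> / \<beta>) * (\<mu>1 \<bullet> \<mu>1))" .
  qed (use bound step dual range slope in blast)
  show ?thesis
  proof (rule that)
    show "0 < \<epsilon> / K" using \<open>0 < \<epsilon>\<close> \<open>0 < K\<close> by simp
  qed (use contraction in blast)
qed

section \<open>Linear convergence\<close>

lemma Q_linear_imp_R_linear:
  fixes G a :: "nat \<Rightarrow> real"
  assumes "0 \<le> q" "q < 1" and G: "\<forall>k. G (Suc k) \<le> q * G k" and a: "\<forall>k. a k \<le> G k"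
  shows "\<exists>c r. 0 \<le> r \<and> r < 1 \<and> (\<forall>k. sqrt (a k) \<le> c * r ^ k)"
proof (intro exI conjI allI)
  have G_pow: "G k \<le> q ^ k * G 0" for k
  proof (induction k)
    case (Suc k)
    have "G (Suc k) \<le> q * G k" using G by blast
    also have "\<dots> \<le> q * (q ^ k * G 0)" using Suc \<open>0 \<le> q\<close> by (rule mult_left_mono)
    finally show ?case by (simp add: mult.assoc)
  qed simp
  fix k
  have "sqrt (a k) \<le> sqrt (q ^ k * G 0)" using a G_pow[of k] by (meson order_trans real_sqrt_le_mono)
  also have "\<dots> = sqrt (G 0) * sqrt q ^ k" by (simp add: real_sqrt_mult real_sqrt_power mult.commute)
  finally show "sqrt (a k) \<le> sqrt (G 0) * sqrt q ^ k" .
qed (use assms in auto)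

lemma dual_error_in_range:
  fixes A :: "real^'n^'e" and lam :: "nat \<Rightarrow> real^'e"
  assumes "lam 0 = 0" "\<And>k. lam (Suc k) = lam k + \<beta> *\<^sub>R (A *v x (Suc k))" "ls \<in> range ((*v) A)"
  shows "lam k - ls \<in> range ((*v) A)"
proof -
  have sub: "subspace (range ((*v) A))"
    by (rule linear_subspace_image) (simp_all add: matrix_vector_mul_linear)
  have "lam k \<in> range ((*v) A)"
  proof (induction k)
    case 0
    show ?case using assms(1) by (metis matrix_vector_mult_0_right rangeI)
  next
    case (Suc k)
    then show ?case using assms(2) sub by (simp add: subspace_add subspace_scale)
  qed
  then show ?thesis using assms(3) by (rule subspace_diff[OF sub])
qed

lemma flexpd_Q_linear:
  fixes A :: "real^'n^'e" and B :: "real^'n^'n" and df d2f :: "'n \<Rightarrow> real \<Rightarrow> real"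
    and x :: "nat \<Rightarrow> real^'n" and lam :: "nat \<Rightarrow> real^'e"
  assumes B_sym: "transpose B = B" and B_psd: "\<forall>v. 0 \<le> v \<bullet> (B *v v)"
    and mL: "0 < m" "m \<le> L"
    and d2f: "\<And>i t. (df i has_real_derivative d2f i t) (at t)"
    and d2f_bnd: "\<And>i t. m \<le> d2f i t \<and> d2f i t \<le> L"
    and xs_feas: "A *v xs = 0" and ls_KKT: "grad df xs + transpose A *v ls = 0"
    and xs_B: "B *v xs = 0" and ls_col: "ls \<in> range ((*v) A)"
    and T: "1 \<le> T" and \<alpha>: "0 < \<alpha>" and \<eta>: "0 < \<eta>" "\<eta> < 2 * m"
    and \<beta>: "0 < \<beta>" "\<beta> < (2 * m - \<eta>) / rho (transpose A ** A)"
    and \<alpha>_bnd: "\<alpha> < (1 - (L\<^sup>2 / (L\<^sup>2 + \<eta> * rho B)) powr (1 / real T)) / rho B"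
    and lam0: "lam 0 = 0"
    and x_step: "\<And>k. x (Suc k) = flex_inner \<alpha> A B df (x k) (lam k) T"
    and lam_step: "\<And>k. lam (Suc k) = lam k + \<beta> *\<^sub>R (A *v x (Suc k))"
  obtains \<delta> where "0 < \<delta>" "\<forall>k. GC_normsq \<alpha> \<beta> B T (x (Suc k) - xs) (lam (Suc k) - ls)
                  \<le> 1 / (1 + \<delta>) * GC_normsq \<alpha> \<beta> B T (x k - xs) (lam k - ls)"
proof -
  have \<rho>B: "\<alpha> * rho B < 1" using stepsize_bound_rho[OF \<alpha> rho_nonneg[OF B_sym B_psd] \<alpha>_bnd] by blast
  have \<rho>A: "\<beta> * rho (transpose A ** A) < 2 * m - \<eta>"
    using less_divide_imp_mult_less(2)[OF \<beta>] \<eta> by simp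
  obtain \<kappa> where \<kappa>: "\<alpha> * L\<^sup>2 / \<eta> < \<kappa>" "\<forall>v. \<kappa> * (v \<bullet> v) \<le> v \<bullet> (Mmat \<alpha> B T *v v)"
    using Mmat_quadratic_form_gt[OF B_sym B_psd \<alpha> T order_less_le_trans[OF mL] \<eta>(1) \<alpha>_bnd] .
  obtain \<delta> where "0 < \<delta>" and contraction: "\<forall>e0 e1 d \<mu>0 \<mu>1.
      Mmat \<alpha> B T *v (e1 - e0) + \<alpha> *\<^sub>R (B *v e1) + \<alpha> *\<^sub>R (d + transpose A *v \<mu>0) = 0 \<longrightarrow>
      \<mu>1 = \<mu>0 + \<beta> *\<^sub>R (A *v e1) \<longrightarrow> \<mu>1 \<in> range ((*v) A) \<longrightarrow> diagonal_slope m L d e0 \<longrightarrow>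
      GC_normsq \<alpha> \<beta> B T e1 \<mu>1 \<le> 1 / (1 + \<delta>) * GC_normsq \<alpha> \<beta> B T e0 \<mu>0"
    unfolding GC_normsq_def
    using primal_dual_contraction[OF Mmat_symmetric[OF B_sym B_psd \<alpha> \<rho>B T] \<kappa>(2,1) B_psd
        \<alpha> \<beta>(1) mL \<eta>(1) \<rho>A] by blast
  have "GC_normsq \<alpha> \<beta> B T (x (Suc k) - xs) (lam (Suc k) - ls)
      \<le> 1 / (1 + \<delta>) * GC_normsq \<alpha> \<beta> B T (x k - xs) (lam k - ls)" for k
  proof -
    have step: "Mmat \<alpha> B T *v (x (Suc k) - xs - (x k - xs)) + \<alpha> *\<^sub>R (B *v (x (Suc k) - xs))
        + \<alpha> *\<^sub>R ((grad df (x k) - grad df xs) + transpose A *v (lam k - ls)) = 0"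
      unfolding x_step by (rule flex_inner_error_identity[OF B_sym B_psd \<alpha> \<rho>B T xs_B ls_KKT])
    have dual: "lam (Suc k) - ls = (lam k - ls) + \<beta> *\<^sub>R (A *v (x (Suc k) - xs))"
      using xs_feas by (simp add: lam_step matrix_vector_mult_diff_distrib)
    show ?thesis
      by (rule contraction[rule_format, OF step dual dual_error_in_range[OF lam0 lam_step ls_col]
            grad_diff_diagonal_slope[OF d2f d2f_bnd]])
  qed
  with \<open>0 < \<delta>\<close> that show ?thesis by blast
qed

theorem theorem3p18:
  fixes A :: "real^'n^'e" and B :: "real^'n^'n"
    and f df d2f :: "'n \<Rightarrow> real \<Rightarrow> real"
    and m L \<alpha> \<beta> \<eta>4 :: real and T :: nat
    and x :: "nat \<Rightarrow> real^'n" and lam :: "nat \<Rightarrow> real^'e"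
    and xs :: "real^'n" and ls :: "real^'e"
  assumes inc: "incidence_matrix A" and conn: "graph_connected A"
    and B_sym: "transpose B = B"
    and B_psd: "\<forall>v. 0 \<le> v \<bullet> (B *v v)"
    and B_null: "{v. B *v v = 0} = {v. A *v v = 0}"
    and B_edges: "\<forall>i j. i \<noteq> j \<and> B$i$j \<noteq> 0 \<longrightarrow> adjacent A i j"
    and mL: "0 < m" "m \<le> L"
    and df: "\<And>i t. (f i has_real_derivative df i t) (at t)"
    and d2f: "\<And>i t. (df i has_real_derivative d2f i t) (at t)"
    and d2f_bnd: "\<And>i t. m \<le> d2f i t \<and> d2f i t \<le> L"
    and xs_feas: "A *v xs = 0"
    and xs_min: "\<forall>y. A *v y = 0 \<longrightarrow> (\<Sum>i\<in>UNIV. f i (xs$i)) \<le> (\<Sum>i\<in>UNIV. f i (y$i))"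
    and xs_unique: "\<forall>y. A *v y = 0 \<and> (\<forall>z. A *v z = 0 \<longrightarrow> (\<Sum>i\<in>UNIV. f i (y$i)) \<le> (\<Sum>i\<in>UNIV. f i (z$i))) \<longrightarrow> y = xs"
    and ls_KKT: "grad df xs + transpose A *v ls = 0"
    and xs_B: "B *v xs = 0"
    and ls_col: "ls \<in> range (\<lambda>v. A *v v)"
    and T: "1 \<le> T" and \<alpha>: "0 < \<alpha>"
    and \<eta>4: "0 < \<eta>4" "\<eta>4 < 2 * m"
    and \<beta>: "0 < \<beta>" "\<beta> < (2 * m - \<eta>4) / rho (transpose A ** A)"
    and \<alpha>_bnd: "\<alpha> < (1 - (L\<^sup>2 / (L\<^sup>2 + \<eta>4 * rho B)) powr (1 / real T)) / rho B"
    and lam0: "lam 0 = 0"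
    and x_step: "\<And>k. x (Suc k) = flex_inner \<alpha> A B df (x k) (lam k) T"
    and lam_step: "\<And>k. lam (Suc k) = lam k + \<beta> *\<^sub>R (A *v x (Suc k))"
  shows "\<exists>\<delta>>0.
           (\<forall>k. GC_normsq \<alpha> \<beta> B T (x (Suc k) - xs) (lam (Suc k) - ls)
                  \<le> 1 / (1 + \<delta>) * GC_normsq \<alpha> \<beta> B T (x k - xs) (lam k - ls))
         \<and> (\<exists>c q. 0 \<le> q \<and> q < 1 \<and>
              (\<forall>k. sqrt ((x k - xs) \<bullet> (Mmat \<alpha> B T *v (x k - xs))) \<le> c * q ^ k))"
proof -
  obtain \<delta> where "0 < \<delta>" and Q_linear: "\<forall>k. GC_normsq \<alpha> \<beta> B T (x (Suc k) - xs) (lam (Suc k) - ls)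
      \<le> 1 / (1 + \<delta>) * GC_normsq \<alpha> \<beta> B T (x k - xs) (lam k - ls)"
    using flexpd_Q_linear[OF B_sym B_psd mL d2f d2f_bnd xs_feas ls_KKT xs_B ls_col T \<alpha> \<eta>4 \<beta> \<alpha>_bnd
        lam0 x_step lam_step] by blast
  have "\<forall>k. (x k - xs) \<bullet> (Mmat \<alpha> B T *v (x k - xs)) \<le> GC_normsq \<alpha> \<beta> B T (x k - xs) (lam k - ls)"
    using \<alpha> \<beta>(1) by (simp add: GC_normsq_def)
  then have "\<exists>c q. 0 \<le> q \<and> q < 1 \<and> (\<forall>k. sqrt ((x k - xs) \<bullet> (Mmat \<alpha> B T *v (x k - xs))) \<le> c * q ^ k)"
    using \<open>0 < \<delta>\<close> by (intro Q_linear_imp_R_linear[OF _ _ Q_linear]) simp_all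
  with \<open>0 < \<delta>\<close> Q_linear show ?thesis by blast
qed

end
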